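(* For any non-commutative finite ring $R$, $|\operatorname{Cent}(R)| \geq 4$.
   Context: Rings are associative and not assumed to have a unity. For $r \in R$, the centralizer of $r$ is the subring $C(r) = \{s \in R : rs = sr\}$, and $\operatorname{Cent}(R) = \{C(r) : r \in R\}$ is the set of all distinct centralizers. *)

theory Defs
  imports Main
begin

text \<open>The class \<open>ring\<close> of the library is that of associative rings, with no unity assumed;
  the ring \<open>R\<close> is the whole type.\<close>

definition centralizer :: "'a::ring \<Rightarrow> 'a set" where
  "centralizer r = {s. r * s = s * r}"

definition Cent :: "'a::ring set set" where
  "Cent = range centralizer"

end

theory Submission
  imports Defs
begin

text \<open>Two non-commuting elements \<open>x\<close> and \<open>y\<close> already produce four centralizers, those of
  \<open>0\<close>, \<open>x\<close>, \<open>y\<close> and \<open>x + y\<close>. They are pairwise distinct because they meet the pair \<open>{x, y}\<close> in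
  its four different subsets: both elements, \<open>x\<close> alone, \<open>y\<close> alone, and neither. The last case
  holds since an element commuting with \<open>x + y\<close> commutes with \<open>x\<close> if and only if it commutes
  with \<open>y\<close>, while \<open>x\<close> and \<open>y\<close> each commute with themselves.\<close>

theorem theorem2p6:
  assumes noncommutative: "\<exists>x y :: 'a::{ring, finite}. x * y \<noteq> y * x"
  shows "card (Cent :: 'a set set) \<ge> 4"
proof -
  obtain x y :: 'a where xy: "x * y \<noteq> y * x"
    using noncommutative by blast
  have zero: "x \<in> centralizer 0" "y \<in> centralizer 0"
    by (simp_all add: centralizer_def)
  have left: "x \<in> centralizer x" "y \<notin> centralizer x"
    using xy by (simp_all add: centralizer_def)
  have right: "x \<notin> centralizer y" "y \<in> centralizer y"
    using xy by (simp_all add: centralizer_def)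
  have sum: "x \<notin> centralizer (x + y)" "y \<notin> centralizer (x + y)"
    using xy by (simp_all add: centralizer_def distrib_left distrib_right)
  have "centralizer 0 \<noteq> centralizer x" "centralizer 0 \<noteq> centralizer y"
    "centralizer 0 \<noteq> centralizer (x + y)" "centralizer x \<noteq> centralizer y"
    "centralizer x \<noteq> centralizer (x + y)" "centralizer y \<noteq> centralizer (x + y)"
    using zero left right sum by blast+
  then have "card {centralizer 0, centralizer x, centralizer y, centralizer (x + y)} = 4"
    by simp
  moreover have "{centralizer 0, centralizer x, centralizer y, centralizer (x + y)} \<subseteq> Cent"
    by (auto simp: Cent_def)
  ultimately show ?thesis
    by (metis card_mono finite)
qed

end
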